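(* Let $k \geq 1$ be an integer and let $(G,\Sigma)$ be a $k$-frustrated signed graph. The following statements are equivalent: (1) $(G,\Sigma)$ is $k$-critical; (2) every edge of $G$ is contained in some $k$-signature of $(G,\Sigma)$; (3) for every $k$-signature $\Gamma$ of $(G,\Sigma)$, every edge $e \in E(G)\setminus \Gamma$ is contained in an equilibrated edge-cut of $(G,\Gamma)$.
   Context: A signed graph $(G,\Sigma)$ is a finite graph $G$ (loops and multiple edges allowed) together with a set $\Sigma \subseteq E(G)$ of negative edges; all other edges are positive. A circuit is negative if it contains an odd number of edges of $\Sigma$; $(G,\Sigma)$ is balanced if it has no negative circuit. For $U \subseteq V(G)$, the edge-cut $\partial(U)$ is the set of edges with exactly one end in $U$. Two signatures $\Sigma,\Gamma$ on $G$ are equivalent if $\Gamma = \Sigma \,\Delta\, \partial(U)$ for some $U\subseteq V(G)$ ($\Delta$ = symmetric difference); any set $\Gamma$ equivalent to $\Sigma$ is called a signature of $(G,\Sigma)$, and a $t$-signature if $|\Gamma|=t$. The frustration index $l(G,\Sigma)$ is the minimum cardinality of $E\subseteq E(G)$ with $(G-E,\Sigma-E)$ balanced; $(G,\Sigma)$ is $k$-frustrated if $l(G,\Sigma)=k$, and $k$-critical if moreover $l(G-e,\Sigma-\{e\})<k$ for every $e\in E(G)$. An edge-cut $\partial(U)$ of $(G,\Gamma)$ is equilibrated if it contains equally many edges of $\Gamma$ and of $E(G)\setminus\Gamma$. *)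

theory Defs
  imports Main "HOL-Library.Uprod"
begin

text \<open>
  Undirected multigraphs with loops: edges are elements of an abstract type, and a loop at \<open>v\<close>
  has the pair of ends \<open>Upair v v\<close>.
\<close>

record ('v, 'e) multigraph =
  verts :: "'v set"
  edges :: "'e set"
  ends :: "'e \<Rightarrow> 'v uprod"

locale fin_multigraph =
  fixes G :: "('v, 'e) multigraph"
  assumes finite_verts: "finite (verts G)"
    and finite_edges: "finite (edges G)"
    and ends_in_verts: "e \<in> edges G \<Longrightarrow> set_uprod (ends G e) \<subseteq> verts G"

locale signed_graph = fin_multigraph G for G :: "('v, 'e) multigraph" +
  fixes \<Sigma> :: "'e set"
  assumes negative_edges: "\<Sigma> \<subseteq> edges G"

definition delete_edges :: "('v, 'e) multigraph \<Rightarrow> 'e set \<Rightarrow> ('v, 'e) multigraph" where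
  "delete_edges G E = G\<lparr>edges := edges G - E\<rparr>"

text \<open>
  Circuits are represented by their edge sets. Length 1 gives a loop; length 2 gives a pair of
  parallel edges, for which distinctness of the edge list is needed.
\<close>

definition is_circuit :: "('v, 'e) multigraph \<Rightarrow> 'e set \<Rightarrow> bool" where
  "is_circuit G C \<longleftrightarrow>
    (\<exists>vs es. vs \<noteq> [] \<and> length es = length vs \<and> distinct vs \<and> distinct es \<and>
       set vs \<subseteq> verts G \<and> set es \<subseteq> edges G \<and>
       (\<forall>i < length vs. ends G (es ! i) = Upair (vs ! i) (vs ! (Suc i mod length vs))) \<and>
       C = set es)"

definition negative_circuit :: "('v, 'e) multigraph \<Rightarrow> 'e set \<Rightarrow> 'e set \<Rightarrow> bool" where
  "negative_circuit G \<Sigma> C \<longleftrightarrow> is_circuit G C \<and> odd (card (C \<inter> \<Sigma>))"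

definition balanced :: "('v, 'e) multigraph \<Rightarrow> 'e set \<Rightarrow> bool" where
  "balanced G \<Sigma> \<longleftrightarrow> \<not> (\<exists>C. negative_circuit G \<Sigma> C)"

definition edge_cut :: "('v, 'e) multigraph \<Rightarrow> 'v set \<Rightarrow> 'e set" where
  "edge_cut G U = {e \<in> edges G. \<exists>u v. ends G e = Upair u v \<and> u \<in> U \<and> v \<notin> U}"

definition is_signature :: "('v, 'e) multigraph \<Rightarrow> 'e set \<Rightarrow> 'e set \<Rightarrow> bool" where
  "is_signature G \<Sigma> \<Gamma> \<longleftrightarrow> (\<exists>U \<subseteq> verts G. \<Gamma> = sym_diff \<Sigma> (edge_cut G U))"

definition is_t_signature :: "('v, 'e) multigraph \<Rightarrow> 'e set \<Rightarrow> nat \<Rightarrow> 'e set \<Rightarrow> bool" where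
  "is_t_signature G \<Sigma> t \<Gamma> \<longleftrightarrow> is_signature G \<Sigma> \<Gamma> \<and> card \<Gamma> = t"

definition frustration_index :: "('v, 'e) multigraph \<Rightarrow> 'e set \<Rightarrow> nat" where
  "frustration_index G \<Sigma> =
    Min (card ` {E. E \<subseteq> edges G \<and> balanced (delete_edges G E) (\<Sigma> - E)})"

definition frustrated :: "nat \<Rightarrow> ('v, 'e) multigraph \<Rightarrow> 'e set \<Rightarrow> bool" where
  "frustrated k G \<Sigma> \<longleftrightarrow> frustration_index G \<Sigma> = k"

definition critical :: "nat \<Rightarrow> ('v, 'e) multigraph \<Rightarrow> 'e set \<Rightarrow> bool" where
  "critical k G \<Sigma> \<longleftrightarrow> frustrated k G \<Sigma> \<and>
    (\<forall>e \<in> edges G. frustration_index (delete_edges G {e}) (\<Sigma> - {e}) < k)"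

definition equilibrated_cut :: "('v, 'e) multigraph \<Rightarrow> 'e set \<Rightarrow> 'e set \<Rightarrow> bool" where
  "equilibrated_cut G \<Gamma> D \<longleftrightarrow>
    (\<exists>U \<subseteq> verts G. D = edge_cut G U) \<and> card (D \<inter> \<Gamma>) = card (D \<inter> (edges G - \<Gamma>))"

end

theory Submission
  imports Defs
begin

text \<open>
  By Harary's theorem a signed graph is balanced iff its negative edges form an edge-cut: given a
  cut that works for all edges but one, the last edge either agrees with it, or closes a negative
  circuit with a path, or joins two components, one of which can be switched. Hence deleting \<open>E\<close>
  balances \<open>(G, \<Sigma>)\<close> iff \<open>E\<close> contains a signature, and the frustration index is the minimum size of
  a signature. Since the signatures of \<open>G - e\<close> are the sets \<open>\<Gamma> - {e}\<close> with \<open>\<Gamma>\<close> a signature of \<open>G\<close>,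
  (1) and (2) are equivalent. For (2) and (3), two signatures differ by a cut \<open>D\<close>, and
  switching \<open>\<Gamma>\<close> along \<open>D\<close> preserves its size iff \<open>D\<close> is equilibrated.
\<close>

section \<open>Edge-cuts and edge deletion\<close>

lemma edge_cut_iff:
  assumes "ends G e = Upair a b"
  shows "e \<in> edge_cut G U \<longleftrightarrow> e \<in> edges G \<and> (a \<in> U) \<noteq> (b \<in> U)"
  using assms unfolding edge_cut_def by auto

lemma edge_cut_subset: "edge_cut G U \<subseteq> edges G"
  by (auto simp: edge_cut_def)

lemma edge_cut_empty: "edge_cut G {} = {}"
  by (auto simp: edge_cut_def)

text \<open>An edge lies in a cut iff exactly one of its ends lies in the vertex set, and these
  parities add up under symmetric difference.\<close>

lemma edge_cut_sym_diff:
  "edge_cut G (sym_diff U W) = sym_diff (edge_cut G U) (edge_cut G W)"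
proof (rule set_eqI)
  fix e
  obtain a b where "ends G e = Upair a b"
    by (cases "ends G e")
  from edge_cut_iff[OF this]
  show "e \<in> edge_cut G (sym_diff U W) \<longleftrightarrow> e \<in> sym_diff (edge_cut G U) (edge_cut G W)"
    by auto
qed

lemma delete_edges_simps [simp]:
  "verts (delete_edges G E) = verts G"
  "edges (delete_edges G E) = edges G - E"
  "ends (delete_edges G E) = ends G"
  by (simp_all add: delete_edges_def)

lemma edge_cut_delete_edges: "edge_cut (delete_edges G E) U = edge_cut G U - E"
  by (auto simp: edge_cut_def)

section \<open>Parity along circuits: every edge-cut is balanced\<close>

lemma card_set_Int_eq_card_indices:
  assumes "distinct xs"
  shows "card (set xs \<inter> S) = card {i. i < length xs \<and> xs ! i \<in> S}"
proof -
  have "set xs \<inter> S = (!) xs ` {i. i < length xs \<and> xs ! i \<in> S}"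
    by (auto simp: in_set_conv_nth)
  moreover have "inj_on ((!) xs) {i. i < length xs \<and> xs ! i \<in> S}"
    using assms by (auto simp: inj_on_def nth_eq_iff_index_eq)
  ultimately show ?thesis
    by (simp add: card_image)
qed

lemma card_less_Suc_Collect:
  "card {i. i < Suc n \<and> P i} = card {i. i < n \<and> P i} + (if P n then 1 else 0)"
proof -
  have "{i. i < Suc n \<and> P i} = (if P n then insert n {i. i < n \<and> P i} else {i. i < n \<and> P i})"
    by (auto simp: less_Suc_eq)
  then show ?thesis
    by simp
qed

text \<open>Each change flips the truth value. With \<open>f i\<close> saying that the
  \<open>i\<close>-th vertex of a walk lies in \<open>U\<close>, the changes are the steps of the
  walk that cross the cut of \<open>U\<close>.\<close>

lemma odd_card_changes:
  fixes f :: "nat \<Rightarrow> bool"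
  shows "odd (card {i. i < n \<and> f i \<noteq> f (Suc i)}) \<longleftrightarrow> f 0 \<noteq> f n"
proof (induction n)
  case 0
  then show ?case by simp
next
  case (Suc n)
  then show ?case
    by (subst card_less_Suc_Collect) auto
qed

lemma balanced_edge_cut: "balanced G (edge_cut G U)"
  unfolding balanced_def negative_circuit_def
proof (intro notI, elim exE conjE)
  fix C
  assume "is_circuit G C" and odd: "odd (card (C \<inter> edge_cut G U))"
  then obtain vs es where ne: "vs \<noteq> []" and len: "length es = length vs"
    and dist: "distinct es" and sub: "set es \<subseteq> edges G"
    and ends: "\<And>i. i < length vs \<Longrightarrow> ends G (es ! i) = Upair (vs ! i) (vs ! (Suc i mod length vs))"
    and C: "C = set es"
    unfolding is_circuit_def by auto
  \<comment> \<open>Reducing the index modulo the length makes \<open>f (length vs) = f 0\<close>: a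
    closed walk crosses a cut an even number of times.\<close>
  define f where "f i \<longleftrightarrow> vs ! (i mod length vs) \<in> U" for i
  have "es ! i \<in> edge_cut G U \<longleftrightarrow> f i \<noteq> f (Suc i)" if "i < length vs" for i
  proof -
    have "es ! i \<in> edges G"
      using sub len that by (metis nth_mem subsetD)
    then show ?thesis
      using edge_cut_iff[OF ends[OF that]] that by (simp add: f_def)
  qed
  then have "{i. i < length vs \<and> es ! i \<in> edge_cut G U} = {i. i < length vs \<and> f i \<noteq> f (Suc i)}"
    by blast
  then have "card (C \<inter> edge_cut G U) = card {i. i < length vs \<and> f i \<noteq> f (Suc i)}"
    using card_set_Int_eq_card_indices[OF dist] len C by simp
  then show False
    using odd odd_card_changes[of "length vs" f] by (simp add: f_def)
qed

section \<open>Harary's theorem\<close>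

lemma rtranclp_imp_distinct_path:
  assumes "R\<^sup>*\<^sup>* u v"
  shows "\<exists>vs. vs \<noteq> [] \<and> hd vs = u \<and> last vs = v \<and> distinct vs \<and> successively R vs"
  using assms
proof (induction rule: rtranclp_induct)
  case base
  show ?case
    by (intro exI[of _ "[u]"]) auto
next
  case (step v w)
  then obtain vs where vs: "vs \<noteq> []" "hd vs = u" "last vs = v" "distinct vs" "successively R vs"
    by blast
  show ?case
  proof (cases "w \<in> set vs")
    case True
    \<comment> \<open>When \<open>w\<close> is already on the path, the path is truncated there
      instead of extended.\<close>
    then obtain ys zs where split: "vs = (ys @ [w]) @ zs"
      by (auto dest: split_list)
    have "hd (ys @ [w]) = u"
      using vs(2) unfolding split by (cases ys) auto
    moreover have "successively R (ys @ [w])"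
      using vs(5) unfolding split successively_append_iff by blast
    ultimately show ?thesis
      using vs(4) unfolding split by (intro exI[of _ "ys @ [w]"]) auto
  next
    case False
    with vs step.hyps(2) show ?thesis
      by (intro exI[of _ "vs @ [w]"]) (auto simp: successively_append_iff)
  qed
qed

text \<open>A path from \<open>u\<close> to \<open>v\<close> avoiding \<open>e\<close> closes up
  with \<open>e\<close> to a circuit. The negative edges of the path are those that cross
  \<open>U\<close>, so their parity is fixed by the two ends; a disagreeing sign of \<open>e\<close>
  would make the circuit negative.\<close>

lemma balanced_imp_consistent_edge:
  assumes bal: "balanced G S"
    and e: "e \<in> edges G" "ends G e = Upair u v" and u: "u \<in> verts G"
    and finV: "\<And>e. e \<in> edges G \<Longrightarrow> set_uprod (ends G e) \<subseteq> verts G"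
    and cut: "S \<inter> (edges G - {e}) = edge_cut (delete_edges G {e}) U"
    and reach: "(\<lambda>a b. \<exists>f \<in> edges G - {e}. ends G f = Upair a b)\<^sup>*\<^sup>* u v"
  shows "e \<in> S \<longleftrightarrow> (u \<in> U) \<noteq> (v \<in> U)"
proof (rule ccontr)
  assume incons: "\<not> ?thesis"
  let ?R = "\<lambda>a b. \<exists>f \<in> edges G - {e}. ends G f = Upair a b"
  obtain vs where vs: "vs \<noteq> []" "hd vs = u" "last vs = v" "distinct vs" "successively ?R vs"
    using rtranclp_imp_distinct_path[OF reach] by blast
  obtain n where n: "length vs = Suc n"
    using vs(1) by (cases vs) auto
  have "\<exists>f. f \<in> edges G - {e} \<and> ends G f = Upair (vs ! i) (vs ! Suc i)" if "i < n" for i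
    using successively_nth[OF vs(5)] that n by auto
  then obtain g where g: "\<And>i. i < n \<Longrightarrow> g i \<in> edges G - {e}"
    "\<And>i. i < n \<Longrightarrow> ends G (g i) = Upair (vs ! i) (vs ! Suc i)"
    by metis
  \<comment> \<open>\<open>e\<close> comes last, where the indices of a circuit wrap around from
    \<open>vs ! n\<close> to \<open>vs ! 0\<close>. For a loop \<open>e\<close> a path from
    \<open>u\<close> to itself with \<open>n = 0\<close> gives the circuit of length 1.\<close>
  define es where "es = map g [0..<n] @ [e]"
  have nth: "vs ! 0 = u" "vs ! n = v"
    using vs(1-3) n by (simp_all add: hd_conv_nth last_conv_nth)
  have es_nth: "es ! i = (if i < n then g i else e)" if "i < Suc n" for i
    using that by (auto simp: es_def nth_append)
  \<comment> \<open>The path edges are distinct because an unordered pair of consecutive entries of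
    a distinct list determines its position.\<close>
  have "inj_on g {0..<n}"
  proof (rule inj_onI)
    fix i j
    assume ij: "i \<in> {0..<n}" "j \<in> {0..<n}" "g i = g j"
    then have "Upair (vs ! i) (vs ! Suc i) = Upair (vs ! j) (vs ! Suc j)"
      using g(2)[of i] g(2)[of j] by (metis atLeastLessThan_iff)
    then show "i = j"
      using ij(1,2) n vs(4) by (auto simp: nth_eq_iff_index_eq)
  qed
  moreover have "e \<notin> g ` {0..<n}"
    using g(1) by fastforce
  ultimately have dist: "distinct es"
    by (simp add: es_def distinct_map)
  have "set vs \<subseteq> verts G"
  proof
    fix x
    assume "x \<in> set vs"
    then obtain i where i: "i < Suc n" "x = vs ! i"
      using n by (auto simp: in_set_conv_nth)
    show "x \<in> verts G"
    proof (cases i)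
      case 0
      then show ?thesis using i nth u by simp
    next
      case (Suc j)
      then show ?thesis using i g[of j] finV[of "g j"] by auto
    qed
  qed
  moreover have "ends G (es ! i) = Upair (vs ! i) (vs ! (Suc i mod length vs))" if "i < length vs" for i
    using that n g(2)[of i] e(2) nth es_nth[of i] by (cases "i = n") auto
  moreover have "set es \<subseteq> edges G" "length es = length vs"
    using g(1) e(1) n by (auto simp: es_def)
  ultimately have circ: "is_circuit G (set es)"
    unfolding is_circuit_def using vs(1,4) dist by blast
  have "g i \<in> S \<longleftrightarrow> (vs ! i \<in> U) \<noteq> (vs ! Suc i \<in> U)" if "i < n" for i
  proof -
    have "g i \<in> S \<longleftrightarrow> g i \<in> edge_cut (delete_edges G {e}) U"
      using g(1)[OF that] cut by auto
    also have "\<dots> \<longleftrightarrow> (vs ! i \<in> U) \<noteq> (vs ! Suc i \<in> U)"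
      using edge_cut_iff[of "delete_edges G {e}" "g i"] g[OF that] by simp
    finally show ?thesis .
  qed
  then have "{i. i < n \<and> es ! i \<in> S} = {i. i < n \<and> (vs ! i \<in> U) \<noteq> (vs ! Suc i \<in> U)}"
    using es_nth by auto
  then have "odd (card {i. i < n \<and> es ! i \<in> S}) \<longleftrightarrow> (u \<in> U) \<noteq> (v \<in> U)"
    using odd_card_changes[of n "\<lambda>i. vs ! i \<in> U"] nth by simp
  moreover have "card (set es \<inter> S) = card {i. i < n \<and> es ! i \<in> S} + (if e \<in> S then 1 else 0)"
    unfolding card_set_Int_eq_card_indices[OF dist] using es_nth[of n]
    by (simp add: es_def card_less_Suc_Collect)
  ultimately have "odd (card (set es \<inter> S))"
    using incons by auto
  with circ bal show False
    unfolding balanced_def negative_circuit_def by blast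
qed

lemma balanced_delete_edges:
  assumes "balanced G S"
  shows "balanced (delete_edges G E) S"
proof -
  have "is_circuit G C" if "is_circuit (delete_edges G E) C" for C
    using that unfolding is_circuit_def delete_edges_simps by blast
  then show ?thesis
    using assms unfolding balanced_def negative_circuit_def by blast
qed

lemma fin_multigraph_delete_edges:
  assumes "fin_multigraph G"
  shows "fin_multigraph (delete_edges G E)"
  using assms unfolding fin_multigraph_def by auto

text \<open>Induction on the number of edges. Since \<open>S\<close> need not lie in
  \<open>edges G\<close>, it can stay fixed while an edge is deleted.\<close>

lemma balanced_imp_edge_cut:
  assumes "fin_multigraph G" "balanced G S"
  shows "\<exists>U \<subseteq> verts G. S \<inter> edges G = edge_cut G U"
  using assms
proof (induction "card (edges G)" arbitrary: G)
  case 0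
  then have "edges G = {}"
    by (simp add: fin_multigraph_def)
  then show ?case
    by (auto simp: edge_cut_def)
next
  case (Suc n)
  then interpret fin_multigraph G by simp
  obtain e where e: "e \<in> edges G"
    using Suc.hyps(2) by fastforce
  obtain u v where uv: "ends G e = Upair u v"
    by (cases "ends G e")
  have verts: "u \<in> verts G" "v \<in> verts G"
    using ends_in_verts[OF e] uv by auto
  let ?H = "delete_edges G {e}"
  have "n = card (edges ?H)"
    using Suc.hyps(2) e by simp
  then obtain U where U: "U \<subseteq> verts G" "S \<inter> edges ?H = edge_cut ?H U"
    using Suc.hyps(1)[of ?H] fin_multigraph_delete_edges[OF Suc.prems(1)]
      balanced_delete_edges[OF Suc.prems(2)] by fastforce
  let ?R = "\<lambda>a b. \<exists>f \<in> edges G - {e}. ends G f = Upair a b"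
  \<comment> \<open>A set that cuts \<open>?H\<close> as \<open>U\<close> does and fits the sign of
    \<open>e\<close> is the desired witness. The candidates are \<open>U\<close> and, if
    \<open>e\<close> is a bridge, \<open>sym_diff U K\<close> below.\<close>
  have cutI: "\<exists>W \<subseteq> verts G. S \<inter> edges G = edge_cut G W"
    if "W \<subseteq> verts G" "edge_cut ?H W = edge_cut ?H U" "e \<in> S \<longleftrightarrow> (u \<in> W) \<noteq> (v \<in> W)" for W
  proof -
    have "S \<inter> edges G - {e} = edge_cut G W - {e}"
      using U(2) that(2) by (auto simp: edge_cut_delete_edges)
    moreover have "e \<in> S \<inter> edges G \<longleftrightarrow> e \<in> edge_cut G W"
      using that(3) e edge_cut_iff[OF uv] by simp
    ultimately have "S \<inter> edges G = edge_cut G W"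
      by blast
    with that(1) show ?thesis
      by blast
  qed
  show ?case
  proof (cases "?R\<^sup>*\<^sup>* u v")
    case True
    have "e \<in> S \<longleftrightarrow> (u \<in> U) \<noteq> (v \<in> U)"
      by (rule balanced_imp_consistent_edge[OF Suc.prems(2) e uv verts(1) ends_in_verts _ True])
        (use U(2) in simp_all)
    with cutI U(1) show ?thesis
      by blast
  next
    case False
    \<comment> \<open>\<open>K\<close> is the component of \<open>u\<close> in \<open>?H\<close>. No
      edge of \<open>?H\<close> leaves it, so switching along \<open>K\<close> affects only
      \<open>e\<close>.\<close>
    define K where "K = {w \<in> verts G. ?R\<^sup>*\<^sup>* u w}"
    have uvK: "u \<in> K" "v \<notin> K"
      using False verts by (auto simp: K_def)
    have "edge_cut ?H K = {}"
    proof (rule ccontr)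
      assume "edge_cut ?H K \<noteq> {}"
      then obtain f a b where f: "f \<in> edges G - {e}" "ends G f = Upair a b" "a \<in> K" "b \<notin> K"
        by (auto simp: edge_cut_def)
      then have "?R a b"
        by blast
      moreover have "b \<in> verts G"
        using f ends_in_verts[of f] by auto
      ultimately have "b \<in> K"
        using f(3) unfolding K_def by (auto intro: rtranclp.rtrancl_into_rtrancl)
      with f(4) show False ..
    qed
    then have "edge_cut ?H (sym_diff U K) = edge_cut ?H U"
      by (simp add: edge_cut_sym_diff)
    moreover have "sym_diff U K \<subseteq> verts G"
      using U(1) by (auto simp: K_def)
    moreover have "(u \<in> sym_diff U K) \<noteq> (v \<in> sym_diff U K) \<longleftrightarrow> (u \<in> U) = (v \<in> U)"
      using uvK by blast
    ultimately show ?thesis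
      using cutI U(1) by metis
  qed
qed

lemma balanced_cong:
  assumes "S \<inter> edges G = T \<inter> edges G"
  shows "balanced G S \<longleftrightarrow> balanced G T"
proof -
  have "C \<inter> S = C \<inter> T" if "is_circuit G C" for C
    using that assms unfolding is_circuit_def by blast
  then show ?thesis
    unfolding balanced_def negative_circuit_def by metis
qed

lemma harary:
  assumes "fin_multigraph G"
  shows "balanced G S \<longleftrightarrow> (\<exists>U \<subseteq> verts G. S \<inter> edges G = edge_cut G U)"
  using balanced_imp_edge_cut[OF assms] balanced_edge_cut balanced_cong[of S G]
    edge_cut_subset[of G] by (metis Int_absorb2)

section \<open>Signatures and switching\<close>

lemma is_signature_self: "is_signature G \<Sigma> \<Sigma>"
  unfolding is_signature_def by (intro exI[of _ "{}"]) (simp add: edge_cut_empty)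

lemma is_signature_switch:
  assumes "is_signature G \<Sigma> \<Gamma>" "U \<subseteq> verts G"
  shows "is_signature G \<Sigma> (sym_diff \<Gamma> (edge_cut G U))"
proof -
  obtain W where W: "W \<subseteq> verts G" "\<Gamma> = sym_diff \<Sigma> (edge_cut G W)"
    using assms(1) unfolding is_signature_def by blast
  have "sym_diff \<Gamma> (edge_cut G U) = sym_diff \<Sigma> (edge_cut G (sym_diff W U))"
    unfolding W(2) edge_cut_sym_diff by blast
  moreover have "sym_diff W U \<subseteq> verts G"
    using W(1) assms(2) by blast
  ultimately show ?thesis
    unfolding is_signature_def by blast
qed

text \<open>The signatures form a coset of the group of edge-cuts under symmetric
  difference.\<close>

lemma signatures_differ_by_cut:
  assumes "is_signature G \<Sigma> \<Gamma>" "is_signature G \<Sigma> \<Delta>"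
  shows "\<exists>U \<subseteq> verts G. sym_diff \<Gamma> \<Delta> = edge_cut G U"
proof -
  obtain U W where "U \<subseteq> verts G" "\<Gamma> = sym_diff \<Sigma> (edge_cut G U)"
    "W \<subseteq> verts G" "\<Delta> = sym_diff \<Sigma> (edge_cut G W)"
    using assms unfolding is_signature_def by blast
  then show ?thesis
    by (intro exI[of _ "sym_diff U W"]) (auto simp: edge_cut_sym_diff)
qed

text \<open>Deletion keeps all vertices, so the same sets \<open>U\<close> are available in both
  graphs, and removing \<open>E\<close> commutes with symmetric difference.\<close>

lemma is_signature_delete_edges:
  "is_signature (delete_edges G E) (\<Sigma> - E) \<Gamma> \<longleftrightarrow> (\<exists>\<Delta>. is_signature G \<Sigma> \<Delta> \<and> \<Gamma> = \<Delta> - E)"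
proof -
  have "sym_diff (\<Sigma> - E) (D - E) = sym_diff \<Sigma> D - E" for D
    by blast
  then show ?thesis
    unfolding is_signature_def by (auto simp: edge_cut_delete_edges)
qed

text \<open>Switching trades the elements of \<open>D \<inter> A\<close> for those of
  \<open>D - A\<close>.\<close>

lemma card_sym_diff_eq_iff_equilibrated:
  assumes "finite A" "finite D" "D \<subseteq> X"
  shows "card (sym_diff A D) = card A \<longleftrightarrow> card (D \<inter> A) = card (D \<inter> (X - A))"
proof -
  have "card (sym_diff A D) = card (A - D) + card (D - A)"
    using assms by (subst card_Un_disjoint) auto
  moreover have "card A = card (A - D) + card (D \<inter> A)"
    using assms by (metis Int_commute add.commute card_Int_Diff)
  moreover have "D \<inter> (X - A) = D - A"
    using assms(3) by blast
  ultimately show ?thesis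
    by auto
qed

section \<open>The frustration index in terms of signatures\<close>

context signed_graph
begin

lemma signature_subset: "is_signature G \<Sigma> \<Gamma> \<Longrightarrow> \<Gamma> \<subseteq> edges G"
  using negative_edges edge_cut_subset[of G] unfolding is_signature_def by blast

lemma finite_signature: "is_signature G \<Sigma> \<Gamma> \<Longrightarrow> finite \<Gamma>"
  using signature_subset finite_edges finite_subset by blast

lemma signed_graph_delete_edges: "signed_graph (delete_edges G E) (\<Sigma> - E)"
  using fin_multigraph_delete_edges[OF fin_multigraph_axioms] negative_edges
  by (auto simp: signed_graph_def signed_graph_axioms_def)

text \<open>By Harary's theorem balance means that \<Sigma> agrees with some cut outside
  \<open>E\<close>, so their symmetric difference, a signature, lies inside
  \<open>E\<close>.\<close>

lemma balanced_delete_edges_iff: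
  "balanced (delete_edges G E) (\<Sigma> - E) \<longleftrightarrow> (\<exists>\<Gamma> \<subseteq> E. is_signature G \<Sigma> \<Gamma>)"
proof -
  have "(\<Sigma> - E) \<inter> (edges G - E) = edge_cut G U - E \<longleftrightarrow> sym_diff \<Sigma> (edge_cut G U) \<subseteq> E" for U
    using negative_edges by blast
  then have "balanced (delete_edges G E) (\<Sigma> - E) \<longleftrightarrow>
      (\<exists>U \<subseteq> verts G. sym_diff \<Sigma> (edge_cut G U) \<subseteq> E)"
    unfolding harary[OF fin_multigraph_delete_edges[OF fin_multigraph_axioms]]
    by (simp add: edge_cut_delete_edges)
  then show ?thesis
    by (auto simp only: is_signature_def)
qed

text \<open>A balancing edge set can be shrunk to a signature inside it, and every signature is
  itself balancing.\<close>

lemma frustration_index_le_iff: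
  "frustration_index G \<Sigma> \<le> t \<longleftrightarrow> (\<exists>\<Gamma>. is_signature G \<Sigma> \<Gamma> \<and> card \<Gamma> \<le> t)"
proof -
  let ?A = "{E. E \<subseteq> edges G \<and> balanced (delete_edges G E) (\<Sigma> - E)}"
  have A: "?A = {E. E \<subseteq> edges G \<and> (\<exists>\<Gamma> \<subseteq> E. is_signature G \<Sigma> \<Gamma>)}"
    by (simp add: balanced_delete_edges_iff)
  have "finite ?A"
    using finite_edges by simp
  moreover have "\<Sigma> \<in> ?A"
    unfolding A using is_signature_self negative_edges by blast
  ultimately have "frustration_index G \<Sigma> \<le> t \<longleftrightarrow> (\<exists>E \<in> ?A. card E \<le> t)"
    unfolding frustration_index_def by (subst Min_le_iff) auto
  also have "\<dots> \<longleftrightarrow> (\<exists>\<Gamma>. is_signature G \<Sigma> \<Gamma> \<and> card \<Gamma> \<le> t)"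
  proof
    assume "\<exists>E \<in> ?A. card E \<le> t"
    then obtain E \<Gamma> where "E \<subseteq> edges G" "card E \<le> t" "\<Gamma> \<subseteq> E" "is_signature G \<Sigma> \<Gamma>"
      unfolding A by blast
    moreover from this have "card \<Gamma> \<le> card E"
      using finite_edges by (meson card_mono finite_subset)
    ultimately show "\<exists>\<Gamma>. is_signature G \<Sigma> \<Gamma> \<and> card \<Gamma> \<le> t"
      by (meson order_trans)
  next
    assume "\<exists>\<Gamma>. is_signature G \<Sigma> \<Gamma> \<and> card \<Gamma> \<le> t"
    then show "\<exists>E \<in> ?A. card E \<le> t"
      unfolding A using signature_subset by blast
  qed
  finally show ?thesis .
qed

lemma frustration_index_le_card: "is_signature G \<Sigma> \<Gamma> \<Longrightarrow> frustration_index G \<Sigma> \<le> card \<Gamma>"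
  using frustration_index_le_iff by blast

lemma ex_minimum_signature: "\<exists>\<Gamma>. is_t_signature G \<Sigma> (frustration_index G \<Sigma>) \<Gamma>"
  using frustration_index_le_iff[of "frustration_index G \<Sigma>"] frustration_index_le_card
  unfolding is_t_signature_def by (meson order_antisym order_refl)

lemma frustration_index_delete_edge_less_iff:
  assumes "frustration_index G \<Sigma> \<ge> 1"
  shows "frustration_index (delete_edges G {e}) (\<Sigma> - {e}) < frustration_index G \<Sigma> \<longleftrightarrow>
    (\<exists>\<Gamma>. is_t_signature G \<Sigma> (frustration_index G \<Sigma>) \<Gamma> \<and> e \<in> \<Gamma>)"
    (is "?l < ?k \<longleftrightarrow> _")
proof -
  interpret H: signed_graph "delete_edges G {e}" "\<Sigma> - {e}"
    by (rule signed_graph_delete_edges)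
  have "?l < ?k \<longleftrightarrow> ?l \<le> ?k - 1"
    using assms by auto
  also have "\<dots> \<longleftrightarrow> (\<exists>\<Gamma>. is_signature G \<Sigma> \<Gamma> \<and> card (\<Gamma> - {e}) \<le> ?k - 1)"
    unfolding H.frustration_index_le_iff is_signature_delete_edges by blast
  also have "\<dots> \<longleftrightarrow> (\<exists>\<Gamma>. is_t_signature G \<Sigma> ?k \<Gamma> \<and> e \<in> \<Gamma>)"
  proof -
    \<comment> \<open>No signature has fewer than \<open>?k\<close> elements, so removing
      \<open>e\<close> can only reach \<open>?k - 1\<close> from exactly \<open>?k\<close>. As
      \<open>?k \<ge> 1\<close>, the subtraction is not truncated.\<close>
    have "card (\<Gamma> - {e}) \<le> ?k - 1 \<longleftrightarrow> card \<Gamma> = ?k \<and> e \<in> \<Gamma>" if "is_signature G \<Sigma> \<Gamma>" for \<Gamma>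
      using frustration_index_le_card[OF that] assms finite_signature[OF that]
      by (cases "e \<in> \<Gamma>") (auto simp: card_Diff_singleton)
    then show ?thesis
      unfolding is_t_signature_def by blast
  qed
  finally show ?thesis .
qed

text \<open>Switching \<Gamma> along \<open>D\<close> matches cuts with signatures and preserves the
  size exactly for equilibrated cuts. As \<open>e \<notin> \<Gamma>\<close>, the new signature
  contains \<open>e\<close> iff \<open>D\<close> does.\<close>

lemma ex_equilibrated_cut_iff:
  assumes "is_t_signature G \<Sigma> t \<Gamma>" "e \<notin> \<Gamma>"
  shows "(\<exists>D. equilibrated_cut G \<Gamma> D \<and> e \<in> D) \<longleftrightarrow> (\<exists>\<Delta>. is_t_signature G \<Sigma> t \<Delta> \<and> e \<in> \<Delta>)"
proof -
  have \<Gamma>: "is_signature G \<Sigma> \<Gamma>" "card \<Gamma> = t" "finite \<Gamma>"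
    using assms(1) finite_signature unfolding is_t_signature_def by auto
  have eq: "card (sym_diff \<Gamma> D) = t \<longleftrightarrow> equilibrated_cut G \<Gamma> D"
    if "U \<subseteq> verts G" "D = edge_cut G U" for U D
  proof -
    have D: "D \<subseteq> edges G"
      using that(2) edge_cut_subset by simp
    then have "finite D"
      using finite_edges finite_subset by blast
    from card_sym_diff_eq_iff_equilibrated[OF \<Gamma>(3) this D] show ?thesis
      using \<Gamma>(2) that unfolding equilibrated_cut_def by auto
  qed
  show ?thesis
  proof
    assume "\<exists>D. equilibrated_cut G \<Gamma> D \<and> e \<in> D"
    then obtain D U where D: "equilibrated_cut G \<Gamma> D" "e \<in> D" "U \<subseteq> verts G" "D = edge_cut G U"
      unfolding equilibrated_cut_def by blast
    then have "is_t_signature G \<Sigma> t (sym_diff \<Gamma> D)"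
      using eq is_signature_switch[OF \<Gamma>(1)] unfolding is_t_signature_def by blast
    with D(2) assms(2) show "\<exists>\<Delta>. is_t_signature G \<Sigma> t \<Delta> \<and> e \<in> \<Delta>"
      by blast
  next
    assume "\<exists>\<Delta>. is_t_signature G \<Sigma> t \<Delta> \<and> e \<in> \<Delta>"
    then obtain \<Delta> where \<Delta>: "is_signature G \<Sigma> \<Delta>" "card \<Delta> = t" "e \<in> \<Delta>"
      unfolding is_t_signature_def by blast
    obtain U where U: "U \<subseteq> verts G" "sym_diff \<Gamma> \<Delta> = edge_cut G U"
      using signatures_differ_by_cut[OF \<Gamma>(1) \<Delta>(1)] by blast
    have "sym_diff \<Gamma> (sym_diff \<Gamma> \<Delta>) = \<Delta>"
      by blast
    with eq[OF U] \<Delta>(2) have "equilibrated_cut G \<Gamma> (sym_diff \<Gamma> \<Delta>)"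
      by simp
    with \<Delta>(3) assms(2) show "\<exists>D. equilibrated_cut G \<Gamma> D \<and> e \<in> D"
      by blast
  qed
qed

end

theorem theorem2p2:
  fixes G :: "('v, 'e) multigraph" and \<Sigma> :: "'e set" and k :: nat
  assumes "signed_graph G \<Sigma>"
    and "k \<ge> 1"
    and "frustrated k G \<Sigma>"
  shows "(critical k G \<Sigma> \<longleftrightarrow> (\<forall>e \<in> edges G. \<exists>\<Gamma>. is_t_signature G \<Sigma> k \<Gamma> \<and> e \<in> \<Gamma>)) \<and>
    ((\<forall>e \<in> edges G. \<exists>\<Gamma>. is_t_signature G \<Sigma> k \<Gamma> \<and> e \<in> \<Gamma>) \<longleftrightarrow>
      (\<forall>\<Gamma>. is_t_signature G \<Sigma> k \<Gamma> \<longrightarrow>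
        (\<forall>e \<in> edges G - \<Gamma>. \<exists>D. equilibrated_cut G \<Gamma> D \<and> e \<in> D)))"
proof -
  interpret signed_graph G \<Sigma> by fact
  have k: "frustration_index G \<Sigma> = k"
    using assms(3) by (simp add: frustrated_def)
  have "critical k G \<Sigma> \<longleftrightarrow> (\<forall>e \<in> edges G. \<exists>\<Gamma>. is_t_signature G \<Sigma> k \<Gamma> \<and> e \<in> \<Gamma>)"
    using frustration_index_delete_edge_less_iff assms(2,3) k unfolding critical_def by simp
  moreover have "(\<forall>e \<in> edges G. \<exists>\<Gamma>. is_t_signature G \<Sigma> k \<Gamma> \<and> e \<in> \<Gamma>) \<longleftrightarrow>
      (\<forall>\<Gamma>. is_t_signature G \<Sigma> k \<Gamma> \<longrightarrow>
        (\<forall>e \<in> edges G - \<Gamma>. \<exists>D. equilibrated_cut G \<Gamma> D \<and> e \<in> D))"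
    \<comment> \<open>For (3) to (2) a minimum signature supplies the first \<Gamma>: either it
      contains the given edge already, or (3) gives a cut to switch along.\<close>
    using ex_equilibrated_cut_iff[of k] ex_minimum_signature[unfolded k] by blast
  ultimately show ?thesis
    by blast
qed

end
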